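(* Let $C,D$ be concepts of $\mathcal{L}(\forall,\exists,\geq,-,\sqcap,\sqcup,\top,\bot,\neg)$ (i.e. $\mathcal{ALCQI}$) and let $\mathcal{O}$ be a DL-Lite ontology. Then $C\not\equiv_{\mathcal O} D$ if and only if there is a finite pointed interpretation $(\mathcal I,d)$ with $\mathcal I\models\mathcal O$ and $d\in((C\sqcap\neg D)\sqcup(\neg C\sqcap D))^{\mathcal I}$.
   Context: Concepts over finite sets of concept names and role names are built by $C,D ::= A \mid \top \mid \bot \mid C\sqcap D \mid C\sqcup D \mid \neg C \mid \exists S.C \mid \forall S.C \mid (\geq k\, S.C)$, where $A$ is a concept name, $k\ge 1$, and $S$ is a role name $R$ or its inverse $R^-$, with the standard semantics ($\geq k\,S.C$: at least $k$ pairwise distinct $S$-successors in $C$; $(R^-)^{\mathcal I}$ the converse of $R^{\mathcal I}$). A DL-Lite ontology is a finite set of inclusions $B\sqsubseteq C$ with $B ::= A\mid \exists R\mid\exists R^-$ ($\exists S$ abbreviates $\exists S.\top$) and $C ::= B\mid\neg B$; $\mathcal I\models\mathcal O$ if $B^{\mathcal I}\subseteq C^{\mathcal I}$ for all inclusions. $C\equiv_{\mathcal O}D$ means $C^{\mathcal I}=D^{\mathcal I}$ for all interpretations $\mathcal I\models\mathcal O$. A pointed interpretation $(\mathcal I,d)$ is finite if $\Delta^{\mathcal I}$ is finite. *)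

theory Defs
  imports Main
begin

datatype 'r role = Role 'r | Inv 'r

datatype ('c, 'r) concept =
    Name 'c
  | Top
  | Bot
  | Conj "('c, 'r) concept" "('c, 'r) concept"
  | Disj "('c, 'r) concept" "('c, 'r) concept"
  | Neg "('c, 'r) concept"
  | Exists "'r role" "('c, 'r) concept"
  | Forall "'r role" "('c, 'r) concept"
  | AtLeast nat "'r role" "('c, 'r) concept"

primrec role_over :: "'r set \<Rightarrow> 'r role \<Rightarrow> bool" where
  "role_over NR (Role R) \<longleftrightarrow> R \<in> NR"
| "role_over NR (Inv R) \<longleftrightarrow> R \<in> NR"

primrec concept_over :: "'c set \<Rightarrow> 'r set \<Rightarrow> ('c, 'r) concept \<Rightarrow> bool" where
  "concept_over NC NR (Name A) \<longleftrightarrow> A \<in> NC"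
| "concept_over NC NR Top \<longleftrightarrow> True"
| "concept_over NC NR Bot \<longleftrightarrow> True"
| "concept_over NC NR (Conj C D) \<longleftrightarrow> concept_over NC NR C \<and> concept_over NC NR D"
| "concept_over NC NR (Disj C D) \<longleftrightarrow> concept_over NC NR C \<and> concept_over NC NR D"
| "concept_over NC NR (Neg C) \<longleftrightarrow> concept_over NC NR C"
| "concept_over NC NR (Exists S C) \<longleftrightarrow> role_over NR S \<and> concept_over NC NR C"
| "concept_over NC NR (Forall S C) \<longleftrightarrow> role_over NR S \<and> concept_over NC NR C"
| "concept_over NC NR (AtLeast k S C) \<longleftrightarrow> 1 \<le> k \<and> role_over NR S \<and> concept_over NC NR C"

record ('d, 'c, 'r) interp =
  dom :: "'d set"
  con :: "'c \<Rightarrow> 'd set"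
  rol :: "'r \<Rightarrow> ('d \<times> 'd) set"

text \<open>Only the values at names of the signature matter.\<close>

definition interpretation_over :: "'c set \<Rightarrow> 'r set \<Rightarrow> ('d, 'c, 'r) interp \<Rightarrow> bool" where
  "interpretation_over NC NR I \<longleftrightarrow>
     dom I \<noteq> {} \<and>
     (\<forall>A\<in>NC. con I A \<subseteq> dom I) \<and>
     (\<forall>R\<in>NR. rol I R \<subseteq> dom I \<times> dom I)"

primrec role_ext :: "('d, 'c, 'r) interp \<Rightarrow> 'r role \<Rightarrow> ('d \<times> 'd) set" where
  "role_ext I (Role R) = rol I R"
| "role_ext I (Inv R) = (rol I R)\<inverse>"

primrec ext :: "('d, 'c, 'r) interp \<Rightarrow> ('c, 'r) concept \<Rightarrow> 'd set" where
  "ext I (Name A) = con I A"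
| "ext I Top = dom I"
| "ext I Bot = {}"
| "ext I (Conj C D) = ext I C \<inter> ext I D"
| "ext I (Disj C D) = ext I C \<union> ext I D"
| "ext I (Neg C) = dom I - ext I C"
| "ext I (Exists S C) = {d \<in> dom I. \<exists>e. (d, e) \<in> role_ext I S \<and> e \<in> ext I C}"
| "ext I (Forall S C) = {d \<in> dom I. \<forall>e. (d, e) \<in> role_ext I S \<longrightarrow> e \<in> ext I C}"
| "ext I (AtLeast k S C) =
     {d \<in> dom I. \<exists>X. finite X \<and> card X = k \<and> X \<subseteq> {e. (d, e) \<in> role_ext I S \<and> e \<in> ext I C}}"

text \<open>An inclusion \<open>B \<sqsubseteq> C\<close> is the pair \<open>(B, C)\<close>.\<close>

type_synonym ('c, 'r) ontology = "(('c, 'r) concept \<times> ('c, 'r) concept) set"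

definition basic_concept :: "'c set \<Rightarrow> 'r set \<Rightarrow> ('c, 'r) concept \<Rightarrow> bool" where
  "basic_concept NC NR B \<longleftrightarrow>
     (\<exists>A\<in>NC. B = Name A) \<or>
     (\<exists>R\<in>NR. B = Exists (Role R) Top) \<or>
     (\<exists>R\<in>NR. B = Exists (Inv R) Top)"

definition dl_lite_ontology :: "'c set \<Rightarrow> 'r set \<Rightarrow> ('c, 'r) ontology \<Rightarrow> bool" where
  "dl_lite_ontology NC NR \<O> \<longleftrightarrow>
     finite \<O> \<and>
     (\<forall>(B, C)\<in>\<O>. basic_concept NC NR B \<and>
        (basic_concept NC NR C \<or> (\<exists>B'. basic_concept NC NR B' \<and> C = Neg B')))"

definition satisfies :: "('d, 'c, 'r) interp \<Rightarrow> ('c, 'r) ontology \<Rightarrow> bool" where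
  "satisfies I \<O> \<longleftrightarrow> (\<forall>(B, C)\<in>\<O>. ext I B \<subseteq> ext I C)"

text \<open>
  HOL cannot quantify over all types inside a formula, so equivalence is indexed by the type
  of which interpretation domains are (arbitrary nonempty) subsets. It is meaningful only when
  that type is large enough, in particular infinite.
\<close>

definition equiv_wrt ::
  "'d itself \<Rightarrow> 'c set \<Rightarrow> 'r set \<Rightarrow> ('c, 'r) ontology \<Rightarrow>
   ('c, 'r) concept \<Rightarrow> ('c, 'r) concept \<Rightarrow> bool" where
  "equiv_wrt _ NC NR \<O> C D \<longleftrightarrow>
     (\<forall>I :: ('d, 'c, 'r) interp.
        interpretation_over NC NR I \<and> satisfies I \<O> \<longrightarrow> ext I C = ext I D)"

end

theory Submission imports Defs begin

text \<open>
  Let \<open>d\<close> separate \<open>C\<close> from \<open>D\<close> in a model \<open>I\<close> of the ontology, and let \<open>n\<close> bound the role depths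
  of \<open>C\<close> and \<open>D\<close>. Unravel \<open>I\<close> at \<open>d\<close> into a tree of depth \<open>n\<close>, keeping for every node only the
  finitely many successors needed to witness the number restrictions in \<open>C\<close> and \<open>D\<close>. A node of
  depth \<open>i\<close> then agrees with the element it copies on the relevant concepts of depth at most
  \<open>n - i\<close>. To satisfy the ontology it is enough that every node agrees with its original on basic
  concepts. Since DL-Lite inclusions neither count nor qualify, this is achieved by a finite sink:
  one element in the range of each nonempty role, serving as the successor of every leaf, and of
  every sink element, that needs one.
\<close>

section \<open>Inverse roles and the reduction of quantifiers to number restrictions\<close>

primrec inv_role :: "'r role \<Rightarrow> 'r role" where
  "inv_role (Role R) = Inv R"
| "inv_role (Inv R) = Role R"

lemma inv_role_inv_role [simp]: "inv_role (inv_role S) = S"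
  by (cases S) auto

lemma role_over_inv_role [simp]: "role_over NR (inv_role S) = role_over NR S"
  by (cases S) auto

lemma role_ext_inv_role [simp]: "role_ext I (inv_role S) = (role_ext I S)\<inverse>"
  by (cases S) auto

lemma finite_roles_over:
  assumes "finite NR"
  shows "finite {S. role_over NR S}"
proof (rule finite_subset)
  show "{S. role_over NR S} \<subseteq> Role ` NR \<union> Inv ` NR"
  proof
    fix S assume "S \<in> {S. role_over NR S}"
    then show "S \<in> Role ` NR \<union> Inv ` NR" by (cases S) auto
  qed
  show "finite (Role ` NR \<union> Inv ` NR)" using assms by simp
qed

lemma role_ext_subset_dom:
  assumes "interpretation_over NC NR I" "role_over NR S"
  shows "role_ext I S \<subseteq> dom I \<times> dom I"
  using assms by (cases S) (auto simp: interpretation_over_def)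

lemma ext_subset_dom:
  assumes "interpretation_over NC NR I" "concept_over NC NR E"
  shows "ext I E \<subseteq> dom I"
  using assms by (induction E) (auto simp: interpretation_over_def)

text \<open>Together with the next lemma this leaves \<open>AtLeast\<close> as the only constructor
  that needs an argument about successors.\<close>

lemma ext_Exists_AtLeast: "ext I (Exists S E) = ext I (AtLeast 1 S E)"
proof -
  have "(\<exists>X. finite X \<and> card X = 1 \<and> X \<subseteq> A) \<longleftrightarrow> A \<noteq> {}" for A :: "'a set"
  proof
    assume "\<exists>X. finite X \<and> card X = 1 \<and> X \<subseteq> A"
    then show "A \<noteq> {}" by (auto simp: card_Suc_eq)
  next
    assume "A \<noteq> {}"
    then obtain a where "a \<in> A" by blast
    then show "\<exists>X. finite X \<and> card X = 1 \<and> X \<subseteq> A" by (intro exI[of _ "{a}"]) auto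
  qed
  then show ?thesis by auto
qed

text \<open>\<open>Neg E\<close> is the complement within \<open>dom I\<close>, so this duality
  relies on role successors staying inside the domain.\<close>

lemma ext_Forall_AtLeast:
  assumes "interpretation_over NC NR I" "role_over NR S"
  shows "ext I (Forall S E) = ext I (Neg (AtLeast 1 S (Neg E)))"
proof -
  have "ext I (Forall S E) = ext I (Neg (Exists S (Neg E)))"
    using role_ext_subset_dom[OF assms] by auto
  then show ?thesis
    unfolding ext.simps(6)[of I "Exists S (Neg E)"] ext_Exists_AtLeast by (simp only: ext.simps(6))
qed

lemma dl_lite_ontology_cases:
  assumes "dl_lite_ontology NC NR \<O>" "(B, C) \<in> \<O>"
  shows "basic_concept NC NR B"
    and "basic_concept NC NR C \<or> (\<exists>B'. basic_concept NC NR B' \<and> C = Neg B')"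
  using assms by (auto simp: dl_lite_ontology_def)

lemma concept_over_basic_concept:
  "basic_concept NC NR B \<Longrightarrow> concept_over NC NR B"
  by (auto simp: basic_concept_def)

section \<open>Isomorphic copies of interpretations along injections\<close>

definition image_interp :: "('d \<Rightarrow> 'e) \<Rightarrow> ('d, 'c, 'r) interp \<Rightarrow> ('e, 'c, 'r) interp" where
  "image_interp f I =
     \<lparr>dom = f ` dom I, con = \<lambda>A. f ` con I A, rol = \<lambda>R. map_prod f f ` rol I R\<rparr>"

lemma role_ext_image_interp: "role_ext (image_interp f I) S = map_prod f f ` role_ext I S"
  by (cases S) (force simp: image_interp_def)+

lemma interpretation_over_image_interp:
  "interpretation_over NC NR I \<Longrightarrow> interpretation_over NC NR (image_interp f I)"
  unfolding interpretation_over_def image_interp_def by fastforce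

text \<open>Injectivity makes \<open>f\<close> a bijection from the \<open>S\<close>-successors of
  \<open>x\<close> in \<open>E\<close> onto those of \<open>f x\<close>, so sets of size
  \<open>k\<close> move both ways.\<close>

lemma ext_image_interp_AtLeast:
  assumes I: "interpretation_over NC NR I" and inj: "inj_on f (dom I)"
    and S: "role_over NR S" and E: "concept_over NC NR E"
    and IH: "ext (image_interp f I) E = f ` ext I E"
  shows "ext (image_interp f I) (AtLeast k S E) = f ` ext I (AtLeast k S E)"
proof -
  let ?J = "image_interp f I"
  have key: "(\<exists>X. finite X \<and> card X = k \<and> X \<subseteq> {v. (f x, v) \<in> role_ext ?J S \<and> v \<in> ext ?J E})
      \<longleftrightarrow> (\<exists>X. finite X \<and> card X = k \<and> X \<subseteq> {e. (x, e) \<in> role_ext I S \<and> e \<in> ext I E})"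
    if x: "x \<in> dom I" for x
  proof -
    let ?A = "{e. (x, e) \<in> role_ext I S \<and> e \<in> ext I E}"
    have sub: "role_ext I S \<subseteq> dom I \<times> dom I" "ext I E \<subseteq> dom I"
      using role_ext_subset_dom[OF I S] ext_subset_dom[OF I E] .
    have img: "{v. (f x, v) \<in> role_ext ?J S \<and> v \<in> ext ?J E} = f ` ?A"
    proof (intro equalityI subsetI)
      fix v assume "v \<in> {v. (f x, v) \<in> role_ext ?J S \<and> v \<in> ext ?J E}"
      then obtain y e e' where y: "(y, e) \<in> role_ext I S" "f x = f y" "v = f e"
        and e': "e' \<in> ext I E" "v = f e'"
        unfolding role_ext_image_interp IH by auto
      \<comment> \<open>The edge leaving \<open>f x\<close> is only known to come from some preimage
        \<open>y\<close>, and \<open>v\<close> to be the image of some \<open>e'\<close> in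
        \<open>E\<close>; injectivity on \<open>dom I\<close> identifies these with \<open>x\<close>
        and \<open>e\<close>.\<close>
      moreover have "y = x" "e' = e"
        using inj_onD[OF inj] y e' sub x by (metis mem_Sigma_iff subsetD)+
      ultimately show "v \<in> f ` ?A" by auto
    next
      fix v assume "v \<in> f ` ?A"
      then show "v \<in> {v. (f x, v) \<in> role_ext ?J S \<and> v \<in> ext ?J E}"
        unfolding role_ext_image_interp IH by auto
    qed
    have injA: "inj_on f ?A"
      using inj sub by (auto intro: inj_on_subset)
    show ?thesis
      unfolding img
    proof
      assume "\<exists>X. finite X \<and> card X = k \<and> X \<subseteq> f ` ?A"
      then obtain X where X: "finite X" "card X = k" "X \<subseteq> f ` ?A" by blast
      obtain Y where Y: "Y \<subseteq> ?A" "X = f ` Y"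
        using X(3) by (rule subset_imageE)
      have "inj_on f Y" using injA Y(1) by (rule inj_on_subset)
      then have "finite Y" "card Y = k"
        using X Y(2) by (auto simp: card_image finite_image_iff)
      then show "\<exists>X. finite X \<and> card X = k \<and> X \<subseteq> ?A" using Y(1) by blast
    next
      assume "\<exists>X. finite X \<and> card X = k \<and> X \<subseteq> ?A"
      then obtain X where X: "finite X" "card X = k" "X \<subseteq> ?A" by blast
      then have "card (f ` X) = k" using injA by (simp add: card_image inj_on_subset)
      then show "\<exists>X. finite X \<and> card X = k \<and> X \<subseteq> f ` ?A"
        using X by (intro exI[of _ "f ` X"]) auto
    qed
  qed
  have dom: "dom ?J = f ` dom I" by (simp add: image_interp_def)
  have iff: "f x \<in> ext ?J (AtLeast k S E) \<longleftrightarrow> x \<in> ext I (AtLeast k S E)" if "x \<in> dom I" for x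
    using key[OF that] that dom by simp
  have "ext ?J (AtLeast k S E) \<subseteq> f ` dom I" "ext I (AtLeast k S E) \<subseteq> dom I"
    using dom by auto
  with iff show ?thesis by blast
qed

lemma ext_image_interp_Neg:
  assumes "inj_on f (dom I)" "ext I E \<subseteq> dom I" "ext (image_interp f I) E = f ` ext I E"
  shows "ext (image_interp f I) (Neg E) = f ` ext I (Neg E)"
proof -
  have "f ` (dom I - ext I E) = f ` dom I - f ` ext I E"
    by (rule inj_on_image_set_diff[OF assms(1) _ assms(2)]) blast
  then show ?thesis using assms(3) by (simp add: image_interp_def)
qed

lemma ext_image_interp:
  assumes I: "interpretation_over NC NR I" and inj: "inj_on f (dom I)"
    and E: "concept_over NC NR E"
  shows "ext (image_interp f I) E = f ` ext I E"
  using E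
proof (induction E)
  case (Conj C D)
  then have "ext I C \<subseteq> dom I" "ext I D \<subseteq> dom I" using ext_subset_dom[OF I] by auto
  then have "f ` (ext I C \<inter> ext I D) = f ` ext I C \<inter> f ` ext I D"
    by (rule inj_on_image_Int[OF inj])
  then show ?case using Conj by simp
next
  case (Neg C)
  then show ?case
    using ext_subset_dom[OF I, of C] by (intro ext_image_interp_Neg[OF inj]) auto
next
  case (Exists S E)
  then have "role_over NR S" "concept_over NC NR E" "ext (image_interp f I) E = f ` ext I E"
    by auto
  then show ?case
    unfolding ext_Exists_AtLeast by (rule ext_image_interp_AtLeast[OF I inj])
next
  case (Forall S E)
  then have S: "role_over NR S" and E: "concept_over NC NR E"
    and IH: "ext (image_interp f I) E = f ` ext I E" by auto
  have "ext (image_interp f I) (Neg E) = f ` ext I (Neg E)"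
    by (rule ext_image_interp_Neg[OF inj ext_subset_dom[OF I E] IH])
  then have "ext (image_interp f I) (AtLeast 1 S (Neg E)) = f ` ext I (AtLeast 1 S (Neg E))"
    using E by (intro ext_image_interp_AtLeast[OF I inj S]) simp_all
  then have "ext (image_interp f I) (Neg (AtLeast 1 S (Neg E))) = f ` ext I (Neg (AtLeast 1 S (Neg E)))"
    using S E by (intro ext_image_interp_Neg[OF inj ext_subset_dom[OF I]]) simp_all
  then show ?case
    by (simp only: ext_Forall_AtLeast[OF I S]
      ext_Forall_AtLeast[OF interpretation_over_image_interp[OF I] S])
next
  case (AtLeast k S E)
  then have "role_over NR S" "concept_over NC NR E" "ext (image_interp f I) E = f ` ext I E"
    by auto
  then show ?case by (rule ext_image_interp_AtLeast[OF I inj])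
qed (auto simp: image_interp_def)

lemma satisfies_image_interp:
  assumes I: "interpretation_over NC NR I" and inj: "inj_on f (dom I)"
    and O: "dl_lite_ontology NC NR \<O>" and sat: "satisfies I \<O>"
  shows "satisfies (image_interp f I) \<O>"
  unfolding satisfies_def
proof clarify
  fix B C v assume BC: "(B, C) \<in> \<O>" and v: "v \<in> ext (image_interp f I) B"
  have over: "concept_over NC NR B" "concept_over NC NR C"
    using dl_lite_ontology_cases[OF O BC] by (auto dest: concept_over_basic_concept)
  have "ext I B \<subseteq> ext I C" using sat BC by (auto simp: satisfies_def)
  then show "v \<in> ext (image_interp f I) C"
    using v unfolding over[THEN ext_image_interp[OF I inj]] by blast
qed

section \<open>Role depth and finite sets of witnesses\<close>

primrec role_depth :: "('c, 'r) concept \<Rightarrow> nat" where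
  "role_depth (Name A) = 0"
| "role_depth Top = 0"
| "role_depth Bot = 0"
| "role_depth (Conj C D) = max (role_depth C) (role_depth D)"
| "role_depth (Disj C D) = max (role_depth C) (role_depth D)"
| "role_depth (Neg C) = role_depth C"
| "role_depth (Exists S C) = Suc (role_depth C)"
| "role_depth (Forall S C) = Suc (role_depth C)"
| "role_depth (AtLeast k S C) = Suc (role_depth C)"

text \<open>
  A pair \<open>(k, E)\<close> asks for \<open>k\<close> successors in \<open>E\<close>; \<open>\<forall>S.E\<close> is read as \<open>\<not>(\<ge> 1 S.\<not>E)\<close>.
\<close>

primrec demands :: "('c, 'r) concept \<Rightarrow> (nat \<times> ('c, 'r) concept) set" where
  "demands (Name A) = {}"
| "demands Top = {}"
| "demands Bot = {}"
| "demands (Conj C D) = demands C \<union> demands D"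
| "demands (Disj C D) = demands C \<union> demands D"
| "demands (Neg C) = demands C"
| "demands (Exists S C) = insert (1, C) (demands C)"
| "demands (Forall S C) = insert (1, Neg C) (demands C)"
| "demands (AtLeast k S C) = insert (k, C) (demands C)"

lemma finite_demands: "finite (demands E)"
  by (induction E) auto

text \<open>One set is chosen for each pair in \<open>\<Sigma>\<close> that can be met inside
  \<open>A\<close>; \<open>W\<close> is the union of these finitely many finite sets. Later
  \<open>A\<close> is the set of successors of an element and \<open>F\<close> the extension
  map.\<close>

lemma finite_witnesses:
  assumes "finite \<Sigma>"
  obtains W where "finite W" "W \<subseteq> A"
    "\<And>k E X. (k, E) \<in> \<Sigma> \<Longrightarrow> finite X \<Longrightarrow> card X = k \<Longrightarrow> X \<subseteq> A \<inter> F E \<Longrightarrow>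
       \<exists>Y. finite Y \<and> card Y = k \<and> Y \<subseteq> W \<inter> F E"
proof -
  define P where "P = (\<lambda>p X. finite X \<and> card X = fst p \<and> X \<subseteq> A \<inter> F (snd p))"
  define W where "W = (\<Union>p\<in>{p \<in> \<Sigma>. \<exists>X. P p X}. SOME X. P p X)"
  have P: "P p (SOME X. P p X)" if "\<exists>X. P p X" for p
    using someI_ex[OF that] .
  have sel: "finite (SOME X. P p X)" "(SOME X. P p X) \<subseteq> A" if "\<exists>X. P p X" for p
    using P[OF that] unfolding P_def by blast+
  show thesis
  proof
    show "finite W" unfolding W_def using assms sel(1) by (intro finite_UN_I) simp_all
    show "W \<subseteq> A" unfolding W_def using sel(2) by (intro UN_least) simp
    fix k E X assume kE: "(k, E) \<in> \<Sigma>" and X: "finite X" "card X = k" "X \<subseteq> A \<inter> F E"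
    have ex: "\<exists>X. P (k, E) X" using X by (intro exI[of _ X]) (simp add: P_def)
    let ?Y = "SOME X. P (k, E) X"
    have "?Y \<subseteq> W" unfolding W_def by (rule UN_upper) (use kE ex in simp)
    moreover have "finite ?Y \<and> card ?Y = k \<and> ?Y \<subseteq> A \<inter> F E"
      using P[OF ex] unfolding P_def fst_conv snd_conv .
    ultimately show "\<exists>Y. finite Y \<and> card Y = k \<and> Y \<subseteq> W \<inter> F E" by (intro exI[of _ ?Y]) simp
  qed
qed

section \<open>The finite unravelling with its sink\<close>

text \<open>\<open>W S x\<close> holds the \<open>S\<close>-successors of \<open>x\<close> that are
  kept, \<open>n\<close> is the depth of the tree, and \<open>b S\<close> is the sink element that
  serves as \<open>S\<close>-successor.\<close>

locale unravelling =
  fixes NC :: "'c set" and NR :: "'r set" and I :: "('d, 'c, 'r) interp" and d :: 'd and n :: nat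
    and \<Sigma> :: "(nat \<times> ('c, 'r) concept) set"
    and W :: "'r role \<Rightarrow> 'd \<Rightarrow> 'd set" and b :: "'r role \<Rightarrow> 'd"
  assumes finite_NR: "finite NR"
    and interp: "interpretation_over NC NR I"
    and root: "d \<in> dom I"
    and finite_W: "finite (W S x)"
    and W_succ: "e \<in> W S x \<Longrightarrow> (x, e) \<in> role_ext I S"
    and W_demands: "(k, E) \<in> \<Sigma> \<Longrightarrow> finite X \<Longrightarrow> card X = k \<Longrightarrow>
      X \<subseteq> {e. (x, e) \<in> role_ext I S \<and> e \<in> ext I E} \<Longrightarrow>
      \<exists>Y. finite Y \<and> card Y = k \<and> Y \<subseteq> W S x \<inter> ext I E"
    and Top_demand: "(1, Top) \<in> \<Sigma>"
    and b_Range: "role_ext I S \<noteq> {} \<Longrightarrow> b S \<in> Range (role_ext I S)"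
begin

text \<open>
  Nodes of the tree are paths in \<open>I\<close> starting at \<open>d\<close>, with the latest step at the head of the list.
\<close>

fun tip :: "('r role \<times> 'd) list \<Rightarrow> 'd" where
  "tip [] = d"
| "tip ((S, e) # w) = e"

text \<open>
  Stepping back along the edge just taken is forbidden: in the tree the parent itself is already the
  corresponding successor, and a second copy of it would spoil the counting.
\<close>

fun backtracks :: "('r role \<times> 'd) list \<Rightarrow> 'r role \<Rightarrow> 'd \<Rightarrow> bool" where
  "backtracks [] S e \<longleftrightarrow> False"
| "backtracks ((S', e') # w) S e \<longleftrightarrow> S = inv_role S' \<and> e = tip w"

fun path :: "('r role \<times> 'd) list \<Rightarrow> bool" where
  "path [] \<longleftrightarrow> True"
| "path ((S, e) # w) \<longleftrightarrow> path w \<and> role_over NR S \<and> e \<in> W S (tip w) \<and> \<not> backtracks w S e"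

definition tree :: "('r role \<times> 'd) list set" where
  "tree = {w. path w \<and> length w \<le> n}"

definition sink :: "'d set" where
  "sink = b ` {S. role_over NR S \<and> role_ext I S \<noteq> {}}"

definition origin :: "('r role \<times> 'd) list + 'd \<Rightarrow> 'd" where
  "origin = case_sum tip id"

lemma origin_simps [simp]: "origin (Inl w) = tip w" "origin (Inr x) = x"
  by (simp_all add: origin_def)

definition nodes :: "(('r role \<times> 'd) list + 'd) set" where
  "nodes = Inl ` tree \<union> Inr ` sink"

definition border :: "(('r role \<times> 'd) list + 'd) set" where
  "border = Inl ` {w \<in> tree. length w = n} \<union> Inr ` sink"

text \<open>A sink edge is not a copy of an edge of \<open>I\<close>: \<open>origin v\<close> and
  \<open>b S\<close> lie in the domain and range of \<open>S\<close>, but need not be related to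
  each other.\<close>

definition down :: "'r role \<Rightarrow> ((('r role \<times> 'd) list + 'd) \<times> (('r role \<times> 'd) list + 'd)) set" where
  "down S = {(Inl w, Inl ((S, e) # w)) |w e. (S, e) # w \<in> tree} \<union>
     {(v, Inr (b S)) |v. v \<in> border \<and> origin v \<in> Domain (role_ext I S)}"

text \<open>A step along \<open>Inv R\<close> is an \<open>R\<close>-edge from the child back to its
  parent, hence the converse.\<close>

definition unravelled :: "(('r role \<times> 'd) list + 'd, 'c, 'r) interp" where
  "unravelled = \<lparr>dom = nodes, con = \<lambda>A. {v \<in> nodes. origin v \<in> con I A},
     rol = \<lambda>R. if R \<in> NR then down (Role R) \<union> (down (Inv R))\<inverse> else {}\<rparr>"

lemma role_ext_unravelled:
  "role_over NR S \<Longrightarrow> role_ext unravelled S = down S \<union> (down (inv_role S))\<inverse>"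
  by (cases S) (auto simp: unravelled_def)

lemma dom_unravelled [simp]: "dom unravelled = nodes"
  by (simp add: unravelled_def)

lemma border_subset_nodes: "border \<subseteq> nodes"
  by (auto simp: border_def nodes_def)

lemma treeD: "(S, e) # w \<in> tree \<Longrightarrow>
    w \<in> tree \<and> role_over NR S \<and> (tip w, e) \<in> role_ext I S \<and> \<not> backtracks w S e"
  by (auto simp: tree_def W_succ)

text \<open>Because of the sink edges only membership in domain and range survives under
  \<open>origin\<close>; this is all that basic concepts can see.\<close>

lemma downD:
  assumes "(u, v) \<in> down S" "role_over NR S"
  shows "u \<in> nodes" "v \<in> nodes"
    "origin u \<in> Domain (role_ext I S)" "origin v \<in> Range (role_ext I S)"
proof -
  consider w e where "u = Inl w" "v = Inl ((S, e) # w)" "(S, e) # w \<in> tree"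
    | "v = Inr (b S)" "u \<in> border" "origin u \<in> Domain (role_ext I S)"
    using assms(1) unfolding down_def by blast
  then have "u \<in> nodes \<and> v \<in> nodes \<and>
    origin u \<in> Domain (role_ext I S) \<and> origin v \<in> Range (role_ext I S)"
  proof cases
    case 1
    then show ?thesis using treeD[OF 1(3)] by (auto simp: nodes_def)
  next
    case 2
    then have "role_ext I S \<noteq> {}" by blast
    then have "b S \<in> sink" "b S \<in> Range (role_ext I S)"
      using assms(2) b_Range by (auto simp: sink_def)
    then show ?thesis using 2 border_subset_nodes by (auto simp: nodes_def)
  qed
  then show "u \<in> nodes" "v \<in> nodes"
    "origin u \<in> Domain (role_ext I S)" "origin v \<in> Range (role_ext I S)" by blast+
qed

lemma role_ext_unravelledD:
  assumes "(u, v) \<in> role_ext unravelled S" "role_over NR S"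
  shows "u \<in> nodes" "v \<in> nodes" "origin u \<in> Domain (role_ext I S)"
  using assms downD[of u v S] downD[of v u "inv_role S"]
  by (auto simp: role_ext_unravelled)

lemma Nil_in_tree: "[] \<in> tree"
  by (simp add: tree_def)

lemma interpretation_over_unravelled: "interpretation_over NC NR unravelled"
proof -
  have "rol unravelled R \<subseteq> nodes \<times> nodes" if "R \<in> NR" for R
    using role_ext_unravelledD[of _ _ "Role R"] that by auto
  moreover have "nodes \<noteq> {}" using Nil_in_tree by (auto simp: nodes_def)
  ultimately show ?thesis
    by (auto simp: interpretation_over_def unravelled_def)
qed

text \<open>A path can be extended by finitely many roles and, for each role, only to the finitely
  many elements of \<open>W\<close>.\<close>

lemma finite_paths: "finite {w. path w \<and> length w \<le> m}"
proof (induction m)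
  case (Suc m)
  let ?P = "{w. path w \<and> length w \<le> m}"
  have "{w. path w \<and> length w \<le> Suc m} \<subseteq>
    insert [] (\<Union>w\<in>?P. \<Union>S\<in>{S. role_over NR S}. (\<lambda>e. (S, e) # w) ` W S (tip w))" (is "?L \<subseteq> ?R")
  proof
    fix w assume "w \<in> ?L"
    then show "w \<in> ?R"
    proof (cases w rule: path.cases)
      case (2 S e u)
      then have "u \<in> ?P" "role_over NR S" "e \<in> W S (tip u)" using \<open>w \<in> ?L\<close> by auto
      then show ?thesis using 2 by blast
    qed simp
  qed
  moreover have "finite ?R"
    using Suc finite_W finite_roles_over[OF finite_NR] by simp
  ultimately show ?case by (rule finite_subset)
qed simp

lemma finite_nodes: "finite nodes"
  using finite_paths[of n] finite_roles_over[OF finite_NR]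
  by (simp add: nodes_def tree_def sink_def)

lemma origin_in_dom:
  assumes "v \<in> nodes"
  shows "origin v \<in> dom I"
proof (cases v)
  case (Inl w)
  then have w: "w \<in> tree" using assms by (auto simp: nodes_def)
  show ?thesis
  proof (cases w)
    case Nil
    then show ?thesis using Inl root by simp
  next
    case (Cons p w')
    then show ?thesis
      using Inl w role_ext_subset_dom[OF interp, of "fst p"] by (cases p) (auto dest: treeD)
  qed
next
  case (Inr x)
  then obtain S where "role_over NR S" "role_ext I S \<noteq> {}" "x = b S"
    using assms by (auto simp: nodes_def sink_def)
  then show ?thesis using Inr b_Range[of S] role_ext_subset_dom[OF interp, of S] by auto
qed

section \<open>Agreement of tree nodes with their originals\<close>

text \<open>Sink edges start at the border and end in the sink, so they never touch an inner node;
  its neighbours are its children and its parent.\<close>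

lemma unravelled_successor_inner:
  assumes "w \<in> tree" "length w < n" "role_over NR S" "(Inl w, v) \<in> role_ext unravelled S"
  shows "\<exists>u\<in>tree. v = Inl u \<and> length u \<le> Suc (length w) \<and> (tip w, tip u) \<in> role_ext I S \<and>
    (u = (S, tip u) # w \<or> (\<exists>e. w = (inv_role S, e) # u))"
proof -
  consider "(Inl w, v) \<in> down S" | "(v, Inl w) \<in> down (inv_role S)"
    using assms by (auto simp: role_ext_unravelled)
  then show ?thesis
  proof cases
    case 1
    then obtain e where "v = Inl ((S, e) # w)" "(S, e) # w \<in> tree"
      using assms(2) by (auto simp: down_def border_def)
    then show ?thesis by (auto dest: treeD intro!: bexI[of _ "(S, e) # w"])
  next
    case 2
    then obtain u e where "v = Inl u" "w = (inv_role S, e) # u" by (auto simp: down_def)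
    then show ?thesis using assms(1) by (auto dest: treeD intro!: bexI[of _ u])
  qed
qed

text \<open>Children along the same role are determined by their tips and the parent is unique; a
  child with the tip of the parent would be a backtracking step, which \<open>path\<close>
  forbids.\<close>

lemma inj_on_origin_successors:
  assumes "w \<in> tree" "length w < n" "role_over NR S"
  shows "inj_on origin {v. (Inl w, v) \<in> role_ext unravelled S}"
proof (rule inj_onI)
  have no_copy: "tip u \<noteq> tip u'"
    if "u = (S, tip u) # w" "w = (inv_role S, e) # u'" "u \<in> tree" for u u' e
    using treeD[of S "tip u" w] that by auto
  fix v v' assume *: "v \<in> {v. (Inl w, v) \<in> role_ext unravelled S}"
    "v' \<in> {v. (Inl w, v) \<in> role_ext unravelled S}" "origin v = origin v'"
  obtain u where u: "u \<in> tree" "v = Inl u"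
    "u = (S, tip u) # w \<or> (\<exists>e. w = (inv_role S, e) # u)"
    using unravelled_successor_inner[OF assms, of v] * by auto
  obtain u' where u': "u' \<in> tree" "v' = Inl u'"
    "u' = (S, tip u') # w \<or> (\<exists>e. w = (inv_role S, e) # u')"
    using unravelled_successor_inner[OF assms, of v'] * by auto
  have "tip u = tip u'" using *(3) u(2) u'(2) by simp
  then show "v = v'"
    using u u' no_copy[of u _ u'] no_copy[of u' _ u] by (metis list.inject)
qed

text \<open>A witness is reached at a new child, or, if that step would backtrack, at the parent,
  which has the same tip.\<close>

lemma W_subset_successors:
  assumes "w \<in> tree" "length w < n" "role_over NR S"
  shows "W S (tip w) \<subseteq> origin ` {v. (Inl w, v) \<in> role_ext unravelled S}"
proof
  fix e assume e: "e \<in> W S (tip w)"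
  show "e \<in> origin ` {v. (Inl w, v) \<in> role_ext unravelled S}"
  proof (cases "backtracks w S e")
    case True
    then obtain S' e' u where w: "w = (S', e') # u" "S = inv_role S'" "e = tip u"
      by (cases w) auto
    then have "(Inl w, Inl u) \<in> role_ext unravelled S"
      using assms by (auto simp: role_ext_unravelled down_def)
    then show ?thesis using w(3) by (auto intro!: image_eqI[of _ _ "Inl u"])
  next
    case False
    then have "(S, e) # w \<in> tree" using assms e by (auto simp: tree_def)
    then have "(Inl w, Inl ((S, e) # w)) \<in> role_ext unravelled S"
      using assms by (auto simp: role_ext_unravelled down_def)
    then show ?thesis by (auto intro!: image_eqI[of _ _ "Inl ((S, e) # w)"])
  qed
qed

text \<open>\<open>origin\<close> maps the successors of \<open>Inl w\<close> injectively to
  successors of \<open>tip w\<close> and covers \<open>W S (tip w)\<close>. Sets of successors are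
  pushed forward by \<open>origin\<close> and pulled back from inside \<open>W\<close>.\<close>

lemma AtLeast_unravelled:
  assumes w: "w \<in> tree" "length w < n" and S: "role_over NR S" and dem: "(k, E) \<in> \<Sigma>"
    and IH: "\<And>u. u \<in> tree \<Longrightarrow> length u \<le> Suc (length w) \<Longrightarrow>
      Inl u \<in> ext unravelled E \<longleftrightarrow> tip u \<in> ext I E"
  shows "Inl w \<in> ext unravelled (AtLeast k S E) \<longleftrightarrow> tip w \<in> ext I (AtLeast k S E)"
proof -
  let ?V = "{v. (Inl w, v) \<in> role_ext unravelled S}"
  have succ: "(tip w, origin v) \<in> role_ext I S \<and> (v \<in> ext unravelled E \<longleftrightarrow> origin v \<in> ext I E)"
    if "v \<in> ?V" for v
    using unravelled_successor_inner[OF w S, of v] that IH by auto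
  have inj: "inj_on origin ?V" by (rule inj_on_origin_successors[OF w S])
  have w_dom: "Inl w \<in> nodes" "tip w \<in> dom I"
    using w origin_in_dom[of "Inl w"] by (auto simp: nodes_def)
  have "(\<exists>X. finite X \<and> card X = k \<and> X \<subseteq> {v. v \<in> ?V \<and> v \<in> ext unravelled E}) \<longleftrightarrow>
    (\<exists>X. finite X \<and> card X = k \<and> X \<subseteq> {e. (tip w, e) \<in> role_ext I S \<and> e \<in> ext I E})"
  proof
    assume "\<exists>X. finite X \<and> card X = k \<and> X \<subseteq> {v. v \<in> ?V \<and> v \<in> ext unravelled E}"
    then obtain X where X: "finite X" "card X = k" "X \<subseteq> {v. v \<in> ?V \<and> v \<in> ext unravelled E}"
      by blast
    then have "inj_on origin X" using inj by (auto intro: inj_on_subset)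
    then have "card (origin ` X) = k" using X by (simp add: card_image)
    moreover have "origin ` X \<subseteq> {e. (tip w, e) \<in> role_ext I S \<and> e \<in> ext I E}"
      using X(3) succ by blast
    ultimately show "\<exists>X. finite X \<and> card X = k \<and> X \<subseteq> {e. (tip w, e) \<in> role_ext I S \<and> e \<in> ext I E}"
      using X(1) by blast
  next
    assume "\<exists>X. finite X \<and> card X = k \<and> X \<subseteq> {e. (tip w, e) \<in> role_ext I S \<and> e \<in> ext I E}"
    then obtain Z where "finite Z" "card Z = k"
      "Z \<subseteq> {e. (tip w, e) \<in> role_ext I S \<and> e \<in> ext I E}" by blast
    \<comment> \<open>\<open>Z\<close> may contain successors that were not kept; it is exchanged
      for a set \<open>Y\<close> of the same size inside \<open>W\<close>.\<close>
    from W_demands[OF dem this]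
    obtain Y where Y: "finite Y" "card Y = k" "Y \<subseteq> W S (tip w) \<inter> ext I E" by blast
    then have "Y \<subseteq> origin ` ?V" using W_subset_successors[OF w S] by blast
    then obtain X where X: "X \<subseteq> ?V" "Y = origin ` X"
      by (rule subset_imageE)
    have "inj_on origin X" using inj X(1) by (rule inj_on_subset)
    then have "finite X" "card X = k"
      using X(2) Y by (auto simp: card_image finite_image_iff)
    moreover have "X \<subseteq> {v. v \<in> ?V \<and> v \<in> ext unravelled E}"
      using X Y(3) succ by blast
    ultimately show "\<exists>X. finite X \<and> card X = k \<and> X \<subseteq> {v. v \<in> ?V \<and> v \<in> ext unravelled E}"
      by blast
  qed
  then show ?thesis using w_dom by simp
qed

text \<open>Each role constructor uses up one level of the tree. The depth bound makes
  \<open>w\<close> an inner node whenever successors are inspected, so sink edges stay invisible to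
  \<open>E\<close>.\<close>

lemma ext_unravelled:
  assumes "concept_over NC NR E" "demands E \<subseteq> \<Sigma>" "w \<in> tree" "length w + role_depth E \<le> n"
  shows "Inl w \<in> ext unravelled E \<longleftrightarrow> tip w \<in> ext I E"
  using assms
proof (induction E arbitrary: w)
  case (Name A)
  then show ?case by (auto simp: unravelled_def nodes_def)
next
  case Top
  then show ?case using origin_in_dom[of "Inl w"] by (auto simp: nodes_def)
next
  case (Neg E)
  then show ?case using origin_in_dom[of "Inl w"] by (auto simp: nodes_def)
next
  case (Exists S E)
  have IH: "Inl u \<in> ext unravelled E \<longleftrightarrow> tip u \<in> ext I E"
    if "u \<in> tree" "length u \<le> Suc (length w)" for u
    using Exists.prems that by (intro Exists.IH) simp_all
  show ?case
    unfolding ext_Exists_AtLeast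
    by (rule AtLeast_unravelled) (use Exists.prems IH in \<open>simp_all del: ext.simps\<close>)
next
  case (Forall S E)
  then have S: "role_over NR S" by simp
  have dom: "Inl u \<in> nodes" "tip u \<in> dom I" if "u \<in> tree" for u
    using that origin_in_dom[of "Inl u"] by (auto simp: nodes_def)
  \<comment> \<open>The demand recorded for \<open>Forall S E\<close> is \<open>(1, Neg E)\<close>,
    so agreement is passed on to \<open>Neg E\<close>, which has the same role depth.\<close>
  have IH: "Inl u \<in> ext unravelled (Neg E) \<longleftrightarrow> tip u \<in> ext I (Neg E)"
    if "u \<in> tree" "length u \<le> Suc (length w)" for u
  proof -
    have "Inl u \<in> ext unravelled E \<longleftrightarrow> tip u \<in> ext I E"
      using Forall.prems that by (intro Forall.IH) simp_all
    then show ?thesis using dom[OF that(1)] by simp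
  qed
  have "Inl w \<in> ext unravelled (AtLeast 1 S (Neg E)) \<longleftrightarrow> tip w \<in> ext I (AtLeast 1 S (Neg E))"
    by (rule AtLeast_unravelled) (use Forall.prems IH in \<open>simp_all del: ext.simps\<close>)
  then show ?case
    using dom[OF Forall.prems(3)]
    unfolding ext_Forall_AtLeast[OF interp S] ext_Forall_AtLeast[OF interpretation_over_unravelled S]
      ext.simps(6)[of _ "AtLeast _ _ _"] by (simp del: ext.simps)
next
  case (AtLeast k S E)
  have IH: "Inl u \<in> ext unravelled E \<longleftrightarrow> tip u \<in> ext I E"
    if "u \<in> tree" "length u \<le> Suc (length w)" for u
    using AtLeast.prems that by (intro AtLeast.IH) simp_all
  show ?case
    by (rule AtLeast_unravelled) (use AtLeast.prems IH in \<open>simp_all del: ext.simps\<close>)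
qed auto

section \<open>Preservation of the ontology\<close>

lemma Domain_unravelled:
  assumes v: "v \<in> nodes" and S: "role_over NR S"
  shows "v \<in> Domain (role_ext unravelled S) \<longleftrightarrow> origin v \<in> Domain (role_ext I S)"
proof
  assume "v \<in> Domain (role_ext unravelled S)"
  then show "origin v \<in> Domain (role_ext I S)" using role_ext_unravelledD[OF _ S] by blast
next
  assume succ: "origin v \<in> Domain (role_ext I S)"
  show "v \<in> Domain (role_ext unravelled S)"
  proof (cases "v \<in> border")
    case True
    then have "(v, Inr (b S)) \<in> down S" using succ by (auto simp: down_def)
    then show ?thesis unfolding role_ext_unravelled[OF S] by blast
  next
    case False
    then obtain w where w: "v = Inl w" "w \<in> tree" "length w < n"
      using v by (auto simp: nodes_def border_def) (force simp: tree_def)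
    then obtain e where e: "(tip w, e) \<in> role_ext I S" using succ by auto
    then have "e \<in> dom I" using role_ext_subset_dom[OF interp S] by auto
    \<comment> \<open>The demand \<open>(1, Top)\<close> ensures that an inner node keeps at least
      one \<open>S\<close>-successor whenever its original has any.\<close>
    then obtain Y where "finite Y" "card Y = 1" "Y \<subseteq> W S (tip w) \<inter> ext I Top"
      using W_demands[OF Top_demand, of "{e}" "tip w" S] e by auto
    then have "W S (tip w) \<noteq> {}" by auto
    then show ?thesis using W_subset_successors[OF w(2,3) S] w(1) by auto
  qed
qed

text \<open>In contrast to \<open>ext_unravelled\<close> this covers leaves and sink elements too:
  names are copied from the original, and the sink supplies missing successors.\<close>

lemma basic_concept_unravelled:
  assumes "basic_concept NC NR B" "v \<in> nodes"
  shows "v \<in> ext unravelled B \<longleftrightarrow> origin v \<in> ext I B"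
proof -
  have "v \<in> ext unravelled (Exists S Top) \<longleftrightarrow> origin v \<in> ext I (Exists S Top)"
    if S: "role_over NR S" for S
  proof -
    show ?thesis
      using Domain_unravelled[OF assms(2) S] role_ext_subset_dom[OF interp S]
        role_ext_subset_dom[OF interpretation_over_unravelled S] by auto
  qed
  moreover have "v \<in> ext unravelled (Name A) \<longleftrightarrow> origin v \<in> ext I (Name A)" for A
    using assms(2) by (simp add: unravelled_def)
  ultimately show ?thesis
    using assms(1) by (auto simp: basic_concept_def simp del: ext.simps)
qed

lemma satisfies_unravelled:
  assumes O: "dl_lite_ontology NC NR \<O>" and sat: "satisfies I \<O>"
  shows "satisfies unravelled \<O>"
  unfolding satisfies_def
proof clarify
  fix B C v assume BC: "(B, C) \<in> \<O>" and v: "v \<in> ext unravelled B"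
  note cases = dl_lite_ontology_cases[OF O BC]
  have node: "v \<in> nodes"
    using ext_subset_dom[OF interpretation_over_unravelled concept_over_basic_concept[OF cases(1)]] v
    by auto
  then have "origin v \<in> ext I B" using basic_concept_unravelled[OF cases(1)] v by simp
  then have "origin v \<in> ext I C" using sat BC by (auto simp: satisfies_def)
  \<comment> \<open>For \<open>C = Neg B'\<close> agreement on \<open>B'\<close> is an equivalence,
    so absence of \<open>B'\<close> also carries over to \<open>v\<close>.\<close>
  then show "v \<in> ext unravelled C"
    using cases(2) basic_concept_unravelled[OF _ node] node by auto
qed

end

section \<open>Finite models, change of carrier type, and the equivalence\<close>

lemma finite_unravelling_exists:
  fixes I :: "('d, 'c, 'r) interp"
  assumes NR: "finite NR" and I: "interpretation_over NC NR I" and d: "d \<in> dom I"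
    and O: "dl_lite_ontology NC NR \<O>" and sat: "satisfies I \<O>"
    and E: "concept_over NC NR E"
  shows "\<exists>(J :: (('r role \<times> 'd) list + 'd, 'c, 'r) interp) v.
    interpretation_over NC NR J \<and> finite (dom J) \<and> v \<in> dom J \<and> satisfies J \<O> \<and>
    (v \<in> ext J E \<longleftrightarrow> d \<in> ext I E)"
proof -
  \<comment> \<open>The extra pair \<open>(1, Top)\<close> serves the ontology rather than
    \<open>E\<close>.\<close>
  define \<Sigma> where "\<Sigma> = insert (1, Top) (demands E)"
  have "finite \<Sigma>" by (simp add: \<Sigma>_def finite_demands)
  define Q where "Q = (\<lambda>S x W. finite W \<and> W \<subseteq> {e. (x, e) \<in> role_ext I S} \<and>
    (\<forall>k F X. (k, F) \<in> \<Sigma> \<longrightarrow> finite X \<longrightarrow> card X = k \<longrightarrow>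
       X \<subseteq> {e. (x, e) \<in> role_ext I S} \<inter> ext I F \<longrightarrow>
       (\<exists>Y. finite Y \<and> card Y = k \<and> Y \<subseteq> W \<inter> ext I F)))"
  have "\<exists>W. Q S x W" for S x
  proof (rule finite_witnesses[OF \<open>finite \<Sigma>\<close>, of "{e. (x, e) \<in> role_ext I S}" "ext I"])
    fix W assume "finite W" "W \<subseteq> {e. (x, e) \<in> role_ext I S}"
      "\<And>k F X. (k, F) \<in> \<Sigma> \<Longrightarrow> finite X \<Longrightarrow> card X = k \<Longrightarrow>
         X \<subseteq> {e. (x, e) \<in> role_ext I S} \<inter> ext I F \<Longrightarrow>
         \<exists>Y. finite Y \<and> card Y = k \<and> Y \<subseteq> W \<inter> ext I F"
    then have "Q S x W" unfolding Q_def by simp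
    then show ?thesis ..
  qed
  then obtain W where Q: "Q S x (W S x)" for S x by metis
  then have W: "finite (W S x)" "W S x \<subseteq> {e. (x, e) \<in> role_ext I S}" for S x
    by (simp_all add: Q_def)
  \<comment> \<open>For an empty role this is an arbitrary element, kept out by the nonemptiness
    condition in \<open>sink\<close> and the \<open>Domain\<close> condition in
    \<open>down\<close>.\<close>
  define b where "b = (\<lambda>S. SOME y. y \<in> Range (role_ext I S))"
  interpret unravelling NC NR I d "role_depth E" \<Sigma> W b
  proof unfold_locales
    show "b S \<in> Range (role_ext I S)" if "role_ext I S \<noteq> {}" for S
      unfolding b_def by (rule someI_ex) (use that in auto)
    show "\<exists>Y. finite Y \<and> card Y = k \<and> Y \<subseteq> W S x \<inter> ext I F"
      if "(k, F) \<in> \<Sigma>" "finite X" "card X = k"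
        "X \<subseteq> {e. (x, e) \<in> role_ext I S \<and> e \<in> ext I F}" for k F X x S
    proof -
      have "X \<subseteq> {e. (x, e) \<in> role_ext I S} \<inter> ext I F" using that(4) by blast
      then show ?thesis using Q[of S x] that(1-3) unfolding Q_def by simp
    qed
    show "(x, e) \<in> role_ext I S" if "e \<in> W S x" for e S x
      using W(2)[of S x] that by blast
    show "(1, Top) \<in> \<Sigma>" by (simp add: \<Sigma>_def)
  qed (rule NR I d W(1))+
  \<comment> \<open>The root has length 0, so a tree of depth \<open>role_depth E\<close> suffices
    for all of \<open>E\<close>.\<close>
  have "Inl [] \<in> ext unravelled E \<longleftrightarrow> d \<in> ext I E"
    using ext_unravelled[OF E _ Nil_in_tree] by (simp add: \<Sigma>_def subset_insertI)
  moreover have "Inl [] \<in> nodes" using Nil_in_tree by (auto simp: nodes_def)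
  ultimately show ?thesis
    using interpretation_over_unravelled finite_nodes satisfies_unravelled[OF O sat]
    by (intro exI[of _ unravelled] exI[of _ "Inl []"]) simp
qed

text \<open>An infinite type has subsets of every finite size, so it carries an isomorphic copy of
  any finite model.\<close>

lemma finite_model_transfer:
  fixes I :: "('d, 'c, 'r) interp"
  assumes "infinite (UNIV :: 'e set)"
    and I: "interpretation_over NC NR I" and fin: "finite (dom I)" and d: "d \<in> dom I"
    and O: "dl_lite_ontology NC NR \<O>" and sat: "satisfies I \<O>"
    and E: "concept_over NC NR E" and dE: "d \<in> ext I E"
  shows "\<exists>(J :: ('e, 'c, 'r) interp) v.
    interpretation_over NC NR J \<and> finite (dom J) \<and> v \<in> dom J \<and> satisfies J \<O> \<and> v \<in> ext J E"
proof -
  obtain T :: "'e set" where "finite T" "card T = card (dom I)"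
    using infinite_arbitrarily_large[OF assms(1)] by blast
  then obtain f :: "'d \<Rightarrow> 'e" where inj: "inj_on f (dom I)"
    using fin finite_same_card_bij[of "dom I" T] by (auto simp: bij_betw_def)
  show ?thesis
  proof (intro exI conjI)
    show "interpretation_over NC NR (image_interp f I)"
      by (rule interpretation_over_image_interp[OF I])
    show "finite (dom (image_interp f I))" "f d \<in> dom (image_interp f I)"
      using fin d by (auto simp: image_interp_def)
    show "satisfies (image_interp f I) \<O>" by (rule satisfies_image_interp[OF I inj O sat])
    show "f d \<in> ext (image_interp f I) E" using dE ext_image_interp[OF I inj E] by simp
  qed
qed

theorem theorem4:
  fixes NC :: "'c set" and NR :: "'r set"
    and C D :: "('c, 'r) concept"
    and \<O> :: "('c, 'r) ontology"
  assumes "finite NC" and "finite NR"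
    and "concept_over NC NR C" and "concept_over NC NR D"
    and "dl_lite_ontology NC NR \<O>"
    and "infinite (UNIV :: 'd set)" and "infinite (UNIV :: 'e set)"
  shows "\<not> equiv_wrt TYPE('d) NC NR \<O> C D \<longleftrightarrow>
    (\<exists>(I :: ('e, 'c, 'r) interp) d.
       interpretation_over NC NR I \<and> finite (dom I) \<and> d \<in> dom I \<and> satisfies I \<O> \<and>
       d \<in> ext I (Disj (Conj C (Neg D)) (Conj (Neg C) D)))"
proof -
  let ?E = "Disj (Conj C (Neg D)) (Conj (Neg C) D)"
  have E: "concept_over NC NR ?E" using assms(3,4) by simp
  show ?thesis
  proof
    assume "\<not> equiv_wrt TYPE('d) NC NR \<O> C D"
    then obtain I :: "('d, 'c, 'r) interp" where I: "interpretation_over NC NR I"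
      and sat: "satisfies I \<O>" and ne: "ext I C \<noteq> ext I D"
      by (auto simp: equiv_wrt_def)
    have "ext I C \<subseteq> dom I" "ext I D \<subseteq> dom I"
      using assms(3,4)[THEN ext_subset_dom[OF I]] .
    then obtain d where d: "d \<in> dom I" "d \<in> ext I ?E" using ne by auto
    obtain J :: "(('r role \<times> 'd) list + 'd, 'c, 'r) interp" and v
      where "interpretation_over NC NR J" "finite (dom J)" "v \<in> dom J" "satisfies J \<O>" "v \<in> ext J ?E"
      using finite_unravelling_exists[OF assms(2) I d(1) assms(5) sat E] d(2) by blast
    \<comment> \<open>The unravelling lives on paths and sink elements; it is copied into
      \<open>'e\<close>.\<close>
    from finite_model_transfer[OF assms(7) this(1-3) assms(5) this(4) E this(5)]
    show "\<exists>(I :: ('e, 'c, 'r) interp) d. interpretation_over NC NR I \<and> finite (dom I) \<and>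
      d \<in> dom I \<and> satisfies I \<O> \<and> d \<in> ext I ?E" .
  next
    assume "\<exists>(I :: ('e, 'c, 'r) interp) d. interpretation_over NC NR I \<and> finite (dom I) \<and>
      d \<in> dom I \<and> satisfies I \<O> \<and> d \<in> ext I ?E"
    then obtain I :: "('e, 'c, 'r) interp" and d
      where "interpretation_over NC NR I" "finite (dom I)" "d \<in> dom I" "satisfies I \<O>" "d \<in> ext I ?E"
      by blast
    \<comment> \<open>Equivalence is indexed by \<open>'d\<close>, so the finite counterexample over
      \<open>'e\<close> is copied there.\<close>
    from finite_model_transfer[OF assms(6) this(1-3) assms(5) this(4) E this(5)]
    obtain J :: "('d, 'c, 'r) interp" and v
      where J: "interpretation_over NC NR J" "satisfies J \<O>" "v \<in> ext J ?E"
      by blast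
    have "ext J C \<noteq> ext J D" using J(3) by auto
    then show "\<not> equiv_wrt TYPE('d) NC NR \<O> C D" unfolding equiv_wrt_def using J(1,2) by blast
  qed
qed

end
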